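(* Let $X$ be a separable real Banach space. Then the following are equivalent. (a) $X$ is almost square (ASQ). (b) There exists $h \in X^{****} \setminus \{0\}$ such that for all $x \in X$ $$\|x + h\| = \max\{\|x\|, \|h\|\}.$$
   Context: A Banach space $X$ with unit sphere $S_X$ is almost square (ASQ) if for every $\varepsilon > 0$ and every finite set $(x_i)_{i=1}^n \subset S_X$ there exists $h \in S_X$ such that $\|x_i + h\| \le 1 + \varepsilon$ and $\|x_i - h\| \le 1+\varepsilon$ for every $i = 1, \dots, n$. $X^{****}$ denotes the fourth dual of $X$ (the bidual of the bidual), and $X$ is regarded as a subspace of $X^{****}$ via the canonical embeddings $X \subset X^{**} \subset X^{****}$. *)

theory Defs
  imports "HOL-Analysis.Analysis"
begin

type_synonym 'a dual = "'a \<Rightarrow>\<^sub>L real"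

type_synonym 'a bidual = "'a dual dual"

definition canonical_embedding :: "'a::real_normed_vector \<Rightarrow> 'a bidual" where
  "canonical_embedding x = Blinfun (\<lambda>f. blinfun_apply f x)"

(* Blinfun is only specified on bounded linear functions; this lemma shows that
   the definition above really is evaluation at x. *)
lemma canonical_embedding_apply [simp]:
  "blinfun_apply (canonical_embedding x) f = blinfun_apply f x"
  unfolding canonical_embedding_def
  by (simp add: bounded_linear_Blinfun_apply blinfun.bounded_linear_left)

(* The empty set A is allowed: it only matters for the zero space, which has empty
   unit sphere and hence is not almost square. *)
definition almost_square :: "'a::banach itself \<Rightarrow> bool" where
  "almost_square _ \<longleftrightarrow>
     (\<forall>\<epsilon>>0. \<forall>A \<subseteq> sphere (0::'a) 1. finite A \<longrightarrow>
        (\<exists>h \<in> sphere 0 1. \<forall>x\<in>A. norm (x + h) \<le> 1 + \<epsilon> \<and> norm (x - h) \<le> 1 + \<epsilon>))"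

end

theory Submission
  imports Defs
begin

text \<open>
  An element of the fourth dual that behaves like a vector orthogonal to the whole space in the
  sense of the maximum norm can be replaced, for finitely many vectors and up to an error, by a
  vector of the space itself. Passing from a bidual to the space below it costs an arbitrarily
  small error (lemma \<open>descend_from_bidual\<close>, a special case of the principle of local reflexivity):
  if no vector close to what is required existed, then the convex sets that describe the
  requirements could be separated, and the separating functionals contradict the estimates
  satisfied by the element of the bidual. Two such passages, from the fourth dual to the bidual
  and from there to the space, give almost squareness.

  Conversely, in an almost square space vectors \<open>e 0, e 1, \<dots>\<close> of norm one can be chosen one
  after another such that all signed sums \<open>y \<plusminus> e n \<plusminus> \<dots> \<plusminus> e m\<close> have norm at most
  \<open>1 + 2 / 2 ^ n\<close>, where \<open>y\<close> is zero or one of the first \<open>n\<close> members of a dense sequence of the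
  unit ball (lemma \<open>almost_square_c0_sequence\<close>). Let \<open>k n\<close>, in the bidual, be a weak-star limit
  of the sums \<open>e n + \<dots> + e m\<close> for growing \<open>m\<close>, and \<open>h\<close>, in the fourth dual, a weak-star limit
  of the \<open>k n\<close>. The upper estimates survive, so \<open>x + h\<close> has norm at most one for \<open>x\<close> in the unit
  ball. What must be prevented is that \<open>h\<close> vanishes: the vectors \<open>e n\<close> themselves tend weakly to
  zero, so a limit of them would be useless, and this is why two biduals are needed. A
  functional \<open>f j\<close> of norm one that is norming at \<open>e j\<close> is almost one on every sum that
  contains \<open>e j\<close> and starts late, since the norm remains close to one when all the other signs
  are changed; and it is almost zero on the first members of the dense sequence. A limit \<open>\<Phi>\<close> of the \<open>f j\<close> in the third
  dual therefore satisfies \<open>h \<Phi> \<ge> 1\<close> and vanishes on the space, whence \<open>x + h\<close> has norm at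
  least one for every \<open>x\<close>.

  Separation, norming functionals and limits of bounded sequences in a bidual all come from one
  form of the Hahn--Banach theorem (\<open>Hahn_Banach_sublinear\<close>).
\<close>

section \<open>Sublinear functionals and the Hahn--Banach theorem\<close>

definition sublinear :: "('a::real_vector \<Rightarrow> real) \<Rightarrow> bool" where
  "sublinear p \<longleftrightarrow> (\<forall>x y. p (x + y) \<le> p x + p y) \<and> (\<forall>t\<ge>0. \<forall>x. p (t *\<^sub>R x) = t * p x)"

lemma sublinearI:
  assumes add: "\<And>x y. p (x + y) \<le> p x + p y"
    and zero: "p 0 = 0"
    and scale: "\<And>t x. t > 0 \<Longrightarrow> p (t *\<^sub>R x) \<le> t * p x"
  shows "sublinear p"
  unfolding sublinear_def
proof (intro conjI allI impI add)
  fix t :: real and x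
  assume "t \<ge> 0"
  show "p (t *\<^sub>R x) = t * p x"
  proof (cases "t = 0")
    case False
    with \<open>t \<ge> 0\<close> have t: "t > 0" by simp
    have "p x = p (inverse t *\<^sub>R (t *\<^sub>R x))" using t by simp
    also have "\<dots> \<le> inverse t * p (t *\<^sub>R x)" using t by (intro scale) simp
    finally have "t * p x \<le> p (t *\<^sub>R x)" using t by (simp add: field_simps)
    with scale[OF t, of x] show ?thesis by simp
  qed (simp add: zero)
qed

lemma
  assumes "sublinear p"
  shows sublinear_add: "p (x + y) \<le> p x + p y"
    and sublinear_scale: "t \<ge> 0 \<Longrightarrow> p (t *\<^sub>R x) = t * p x"
    and sublinear_zero: "p 0 = 0"
    and sublinear_minus: "- p (- x) \<le> p x"
proof -
  show add: "p (x + y) \<le> p x + p y" for x y using assms by (simp add: sublinear_def)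
  show scale: "t \<ge> 0 \<Longrightarrow> p (t *\<^sub>R x) = t * p x" for t x using assms by (simp add: sublinear_def)
  show zero: "p 0 = 0" using scale[of 0 0] by simp
  show "- p (- x) \<le> p x" using add[of x "- x"] zero by simp
qed

text \<open>
  Take \<open>q y\<close> to be the infimum of \<open>p (y + t *\<^sub>R x) - t * p x\<close> over \<open>t \<ge> 0\<close>. This has two uses:
  a minimal \<open>p\<close> equals \<open>q\<close> and is therefore odd, and for arbitrary \<open>p\<close> every linear functional
  below \<open>q\<close> agrees with \<open>p\<close> at \<open>x\<close>.
\<close>

lemma sublinear_decrease:
  assumes p: "sublinear p"
  obtains q where "sublinear q" "\<And>y. q y \<le> p y" "q (- x) \<le> - p x"
proof -
  define v where "v y t = p (y + t *\<^sub>R x) - t * p x" for y t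
  define q where "q y = (INF t\<in>{0..}. v y t)" for y
  have lower: "- p (- y) \<le> v y t" if "t \<ge> 0" for y t
    using sublinear_add[OF p, of "y + t *\<^sub>R x" "- y"] sublinear_scale[OF p that, of x]
    by (simp add: v_def)
  have bdd: "bdd_below (v y ` {0..})" for y
    by (rule bdd_belowI[of _ "- p (- y)"]) (auto intro: lower)
  have q_le: "q y \<le> v y t" if "t \<ge> 0" for y t
    unfolding q_def using that by (intro cINF_lower bdd) auto
  have q_ge: "c \<le> q y" if "\<And>t. t \<ge> 0 \<Longrightarrow> c \<le> v y t" for c y
    unfolding q_def using that by (intro cINF_greatest) auto
  have v_add: "v (y + z) (s + t) \<le> v y s + v z t" for y z s t
    using sublinear_add[OF p, of "y + s *\<^sub>R x" "z + t *\<^sub>R x"]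
    by (simp add: v_def algebra_simps)
  have v_scale: "v (r *\<^sub>R y) (r * t) = r * v y t" if "r > 0" for r y t
    using sublinear_scale[OF p, of r "y + t *\<^sub>R x"] that
    by (simp add: v_def algebra_simps)
  show thesis
  proof
    show "sublinear q"
    proof (rule sublinearI)
      fix y z
      have "q (y + z) - v y s \<le> q z" if s: "s \<ge> 0" for s
      proof (rule q_ge)
        fix t :: real assume "t \<ge> 0"
        then have "q (y + z) \<le> v (y + z) (s + t)" using s by (intro q_le) simp
        with v_add[of y z s t] show "q (y + z) - v y s \<le> v z t" by simp
      qed
      then have "q (y + z) - q z \<le> q y" by (intro q_ge) (simp add: algebra_simps)
      then show "q (y + z) \<le> q y + q z" by simp
    next
      have "q 0 \<le> 0" using q_le[of 0 0] by (simp add: v_def sublinear_zero[OF p])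
      moreover have "0 \<le> q 0"
        by (rule q_ge) (simp add: v_def sublinear_scale[OF p])
      ultimately show "q 0 = 0" by simp
    next
      fix r :: real and y assume r: "r > 0"
      have "q (r *\<^sub>R y) / r \<le> q y"
      proof (rule q_ge)
        fix t :: real assume "t \<ge> 0"
        then have "q (r *\<^sub>R y) \<le> r * v y t"
          using q_le[of "r * t" "r *\<^sub>R y"] r by (simp add: v_scale)
        then show "q (r *\<^sub>R y) / r \<le> v y t" using r by (simp add: field_simps)
      qed
      then show "q (r *\<^sub>R y) \<le> r * q y" using r by (simp add: field_simps)
    qed
    show "q y \<le> p y" for y using q_le[of 0 y] by (simp add: v_def)
    show "q (- x) \<le> - p x" using q_le[of 1 "- x"] by (simp add: v_def sublinear_zero[OF p])
  qed
qed

text \<open>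
  Subadditivity survives the infimum since any two members of a chain can be replaced by the
  smaller one; the values of \<open>p\<close> at the opposite points keep the infimum finite.
\<close>

lemma sublinear_INF_chain:
  assumes ne: "C \<noteq> {}"
    and sub: "\<And>g. g \<in> C \<Longrightarrow> sublinear g"
    and le: "\<And>g x. g \<in> C \<Longrightarrow> g x \<le> p x"
    and chain: "\<And>f g. f \<in> C \<Longrightarrow> g \<in> C \<Longrightarrow> f \<le> g \<or> g \<le> f"
  defines "q \<equiv> \<lambda>x. INF g\<in>C. g x"
  shows "sublinear q" and "\<And>g x. g \<in> C \<Longrightarrow> q x \<le> g x"
proof -
  have bdd: "bdd_below ((\<lambda>g. g x) ` C)" for x
  proof (rule bdd_belowI2)
    fix g assume g: "g \<in> C"
    show "- p (- x) \<le> g x" using sublinear_minus[OF sub[OF g], of x] le[OF g, of "- x"] by simp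
  qed
  show q_le: "q x \<le> g x" if "g \<in> C" for g x
    unfolding q_def using that by (intro cINF_lower bdd)
  have q_ge: "c \<le> q x" if "\<And>g. g \<in> C \<Longrightarrow> c \<le> g x" for c x
    unfolding q_def using that by (intro cINF_greatest ne)
  show "sublinear q"
  proof (rule sublinearI)
    fix x y
    have *: "q (x + y) \<le> f x + g y" if f: "f \<in> C" and g: "g \<in> C" for f g
    proof -
      obtain e where e: "e \<in> C" "e \<le> f" "e \<le> g" using chain[OF f g] f g by auto
      have "q (x + y) \<le> e x + e y"
        using q_le[OF e(1), of "x + y"] sublinear_add[OF sub[OF e(1)], of x y] by simp
      also have "\<dots> \<le> f x + g y" using e(2,3) by (intro add_mono) (auto simp: le_fun_def)
      finally show ?thesis .
    qed
    have "q (x + y) - f x \<le> q y" if "f \<in> C" for f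
      using *[OF that] by (intro q_ge) (simp add: algebra_simps)
    then have "q (x + y) - q y \<le> q x" by (intro q_ge) (simp add: algebra_simps)
    then show "q (x + y) \<le> q x + q y" by simp
  next
    have "(\<lambda>g. g 0) ` C = {0}" using ne sublinear_zero[OF sub] by force
    then show "q 0 = 0" by (simp add: q_def)
  next
    fix t :: real and x assume t: "t > 0"
    have "q (t *\<^sub>R x) / t \<le> q x"
    proof (rule q_ge)
      fix g assume g: "g \<in> C"
      show "q (t *\<^sub>R x) / t \<le> g x"
        using q_le[OF g, of "t *\<^sub>R x"] sublinear_scale[OF sub[OF g], of t x] t
        by (simp add: field_simps)
    qed
    then show "q (t *\<^sub>R x) \<le> t * q x" using t by (simp add: field_simps)
  qed
qed

lemma sublinear_odd_imp_linear:
  assumes q: "sublinear q" and odd: "\<And>x. q (- x) \<le> - q x"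
  shows "linear q"
proof -
  have neg: "q (- x) = - q x" for x using odd[of x] sublinear_minus[OF q, of x] by simp
  show ?thesis
  proof (rule linearI)
    fix x y
    show "q (x + y) = q x + q y"
      using sublinear_add[OF q, of x y] sublinear_add[OF q, of "x + y" "- y"] neg[of y] by simp
  next
    fix t x
    show "q (t *\<^sub>R x) = t *\<^sub>R q x"
    proof (cases "t \<ge> 0")
      case True then show ?thesis by (simp add: sublinear_scale[OF q])
    next
      case False
      then show ?thesis using sublinear_scale[OF q, of "- t" x] neg[of "t *\<^sub>R x"] by simp
    qed
  qed
qed

text \<open>
  A minimal sublinear functional below \<open>p\<close>, which Zorn's lemma provides, is linear: it cannot be
  decreased in any direction.
\<close>

lemma sublinear_dominates_linear:
  assumes p: "sublinear p"
  obtains f where "linear f" "\<And>x. f x \<le> p x"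
proof -
  define A where "A = {g. sublinear g \<and> (\<forall>x. g x \<le> p x)}"
  have "\<exists>m\<in>A. \<forall>a\<in>A. m \<ge> a \<longrightarrow> a = m"
  proof (rule predicate_Zorn)
    show "partial_order_on A (relation_of (\<ge>) A)"
      by (rule partial_order_on_relation_ofI) auto
  next
    fix C assume C: "C \<in> Chains (relation_of (\<ge>) A)"
    have CA: "C \<subseteq> A" using C by (auto simp: Chains_def relation_of_def)
    show "\<exists>u\<in>A. \<forall>a\<in>C. a \<ge> u"
    proof (cases "C = {}")
      case True
      then show ?thesis using p by (auto simp: A_def)
    next
      case False
      define q where "q = (\<lambda>x. INF g\<in>C. g x)"
      have chain: "f \<le> g \<or> g \<le> f" if "f \<in> C" "g \<in> C" for f g
        using C that by (auto simp: Chains_def relation_of_def)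
      have CD: "\<And>g. g \<in> C \<Longrightarrow> sublinear g" "\<And>g x. g \<in> C \<Longrightarrow> g x \<le> p x"
        using CA by (auto simp: A_def)
      have q: "sublinear q" and q_le: "\<And>g x. g \<in> C \<Longrightarrow> q x \<le> g x"
        unfolding q_def using sublinear_INF_chain[OF False, where p = p] CD chain by auto
      obtain g where "g \<in> C" using False by auto
      then have "q x \<le> p x" for x using order_trans[OF q_le[of g x] CD(2)[of g x]] by blast
      then show ?thesis using q q_le by (intro bexI[of _ q]) (auto simp: A_def le_fun_def)
    qed
  qed
  then obtain m where "m \<in> A" and m_min: "\<And>a. a \<in> A \<Longrightarrow> a \<le> m \<Longrightarrow> a = m" by blast
  then have m: "sublinear m" "\<And>x. m x \<le> p x" by (auto simp: A_def)
  have minimal: "a = m" if "sublinear a" "\<And>x. a x \<le> m x" for a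
  proof (rule m_min)
    show "a \<in> A" using that order_trans[OF that(2) m(2)] by (simp add: A_def)
    show "a \<le> m" using that(2) by (rule le_funI)
  qed
  have "m (- x) \<le> - m x" for x
  proof -
    obtain a where "sublinear a" "\<And>y. a y \<le> m y" "a (- x) \<le> - m x"
      using sublinear_decrease[OF m(1), of x] by blast
    with minimal[of a] show ?thesis by auto
  qed
  then show thesis using sublinear_odd_imp_linear[OF m(1)] m(2) that by blast
qed

text \<open>
  Decreasing \<open>p\<close> in the direction of \<open>x\<close> first forces every linear minorant to take the value
  \<open>p x\<close> at \<open>x\<close>; this stands in for the extension of a functional from the line through \<open>x\<close>.
\<close>

theorem Hahn_Banach_sublinear:
  assumes p: "sublinear p"
  obtains f where "linear f" "\<And>y. f y \<le> p y" "f x = p x"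
proof -
  obtain q where q: "sublinear q" "\<And>y. q y \<le> p y" "q (- x) \<le> - p x"
    using sublinear_decrease[OF p, of x] by blast
  obtain f where f: "linear f" "\<And>y. f y \<le> q y"
    using sublinear_dominates_linear[OF q(1)] by blast
  show thesis
  proof
    show "linear f" by fact
    show le: "f y \<le> p y" for y using f(2)[of y] q(2)[of y] by simp
    show "f x = p x"
      using f(2)[of "- x"] q(3) le[of x] linear_neg[OF f(1), of x] by simp
  qed
qed

section \<open>Norming functionals and separation\<close>

lemma linear_le_norm_imp_bounded:
  fixes f :: "'a::real_normed_vector \<Rightarrow> real"
  assumes f: "linear f" and le: "\<And>x. f x \<le> norm x * B"
  shows "bounded_linear f"
proof (rule bounded_linear_intro[of _ B])
  show "f (x + y) = f x + f y" for x y using f by (rule linear_add)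
  show "f (r *\<^sub>R x) = r *\<^sub>R f x" for r x using f by (rule linear_scale)
  show "norm (f x) \<le> norm x * B" for x
    using le[of x] le[of "- x"] linear_neg[OF f, of x] by (simp add: abs_le_iff)
qed

lemma norming_functional:
  fixes x :: "'a::real_normed_vector"
  obtains f :: "'a dual" where "norm f \<le> 1" "blinfun_apply f x = norm x"
proof -
  have "sublinear (norm :: 'a \<Rightarrow> real)"
    by (rule sublinearI) (auto intro: norm_triangle_ineq)
  then obtain g where g: "linear g" "\<And>y. g y \<le> norm (y::'a)" "g x = norm x"
    using Hahn_Banach_sublinear[of norm x] by blast
  have bl: "bounded_linear g"
    using g by (intro linear_le_norm_imp_bounded[of _ 1]) auto
  show thesis
  proof
    show "norm (Blinfun g) \<le> 1"
    proof (rule norm_blinfun_bound)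
      show "norm (blinfun_apply (Blinfun g) y) \<le> 1 * norm y" for y
        using g(2)[of y] g(2)[of "- y"] linear_neg[OF g(1), of y]
        by (simp add: bounded_linear_Blinfun_apply[OF bl] abs_le_iff)
    qed simp
    show "blinfun_apply (Blinfun g) x = norm x"
      using g(3) by (simp add: bounded_linear_Blinfun_apply[OF bl])
  qed
qed

text \<open>
  Reflecting \<open>K\<close> through one of its points \<open>k\<close> gives a neighbourhood \<open>U\<close> of the origin that
  misses \<open>k\<close>. A linear functional below the Minkowski gauge of \<open>U\<close> which agrees with the gauge
  at \<open>k\<close> is at least 1 at \<open>k\<close> and less than 1 on \<open>U\<close>.
\<close>

lemma open_convex_positive_functional:
  fixes K :: "'a::real_normed_vector set"
  assumes K: "open K" "convex K" "0 \<notin> K" "K \<noteq> {}"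
  obtains f where "bounded_linear f" "\<And>x. x \<in> K \<Longrightarrow> f x > (0::real)"
proof -
  obtain k where k: "k \<in> K" using K(4) by auto
  define U where "U = (\<lambda>x. k - x) ` K"
  have mem: "u \<in> U \<longleftrightarrow> k - u \<in> K" for u
    by (auto simp: U_def image_iff intro!: bexI[of _ "k - u"])
  have "open U" unfolding U_def
    using open_translation[OF open_negations[OF K(1)], of k] by (simp add: image_image)
  have "convex U" unfolding U_def
    using convex_translation[OF convex_negations[OF K(2)], of k] by (simp add: image_image)
  have "0 \<in> U" "k \<notin> U" using k K(3) by (auto simp: mem)
  define S where "S x = {t. t > 0 \<and> (1 / t) *\<^sub>R x \<in> U}" for x
  define p where "p x = Inf (S x)" for x
  obtain r where r: "r > 0" "ball 0 r \<subseteq> U"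
    using \<open>open U\<close> \<open>0 \<in> U\<close> open_contains_ball by blast
  have S_big: "t \<in> S x" if "norm x / r < t" for x t
  proof -
    have t: "t > 0" using that r(1) by (meson divide_nonneg_pos le_less_trans norm_ge_zero)
    have "norm ((1 / t) *\<^sub>R x) < r" using that t r(1) by (simp add: field_simps)
    then show ?thesis using r(2) t by (auto simp: S_def)
  qed
  have S_ne: "S x \<noteq> {}" for x using S_big[of x "norm x / r + 1"] by auto
  have bdd: "bdd_below (S x)" for x by (rule bdd_belowI[of _ 0]) (auto simp: S_def)
  have p_le: "p x \<le> t" if "t \<in> S x" for x t unfolding p_def using that bdd by (rule cInf_lower)
  have p_ge: "c \<le> p x" if "\<And>t. t \<in> S x \<Longrightarrow> c \<le> t" for c x
    unfolding p_def using that by (intro cInf_greatest S_ne)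
  have p_norm: "p x \<le> norm x / r" for x
    by (rule dense_ge) (auto intro: p_le S_big)
  have p_nonneg: "0 \<le> p x" for x by (rule p_ge) (auto simp: S_def)
  have "sublinear p"
  proof (rule sublinearI)
    fix x y
    have *: "s + t \<in> S (x + y)" if s: "s \<in> S x" and t: "t \<in> S y" for s t
    proof -
      have st: "s > 0" "t > 0" using s t by (auto simp: S_def)
      have "s / (s + t) + t / (s + t) = 1" using st by (subst add_divide_distrib[symmetric]) simp
      then have "(s / (s + t)) *\<^sub>R ((1 / s) *\<^sub>R x) + (t / (s + t)) *\<^sub>R ((1 / t) *\<^sub>R y) \<in> U"
        using s t st by (intro convexD[OF \<open>convex U\<close>]) (auto simp: S_def)
      then show ?thesis using st by (simp add: S_def scaleR_add_right)
    qed
    have "p (x + y) - s \<le> p y" if s: "s \<in> S x" for s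
      by (rule p_ge) (use p_le[OF *[OF s]] in \<open>force simp: algebra_simps\<close>)
    then have "p (x + y) - p y \<le> p x" by (intro p_ge) (simp add: algebra_simps)
    then show "p (x + y) \<le> p x + p y" by simp
  next
    show "p 0 = 0" using p_norm[of 0] p_nonneg[of 0] by simp
  next
    fix t :: real and x assume t: "t > 0"
    have "p (t *\<^sub>R x) / t \<le> p x"
    proof (rule p_ge)
      fix s assume "s \<in> S x"
      then have "t * s \<in> S (t *\<^sub>R x)" using t by (auto simp: S_def)
      from p_le[OF this] show "p (t *\<^sub>R x) / t \<le> s" using t by (simp add: field_simps)
    qed
    then show "p (t *\<^sub>R x) \<le> t * p x" using t by (simp add: field_simps)
  qed
  then obtain f where f: "linear f" "\<And>y. f y \<le> p y" "f k = p k"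
    using Hahn_Banach_sublinear[of p k] by blast
  \<comment> \<open>A value \<open>t < 1\<close> would place \<open>k\<close> on the segment from the origin to a point of \<open>U\<close>.\<close>
  have "1 \<le> p k"
  proof (rule p_ge, rule ccontr)
    fix t assume t: "t \<in> S k" "\<not> 1 \<le> t"
    then have "t *\<^sub>R ((1 / t) *\<^sub>R k) + (1 - t) *\<^sub>R 0 \<in> U"
      using \<open>0 \<in> U\<close> by (intro convexD[OF \<open>convex U\<close>]) (auto simp: S_def)
    then show False using t \<open>k \<notin> U\<close> by (simp add: S_def)
  qed
  \<comment> \<open>The strict inequality uses that \<open>U\<close> is open: \<open>u\<close> can be stretched a little inside \<open>U\<close>.\<close>
  have "p u < 1" if u: "u \<in> U" for u
  proof -
    have "((\<lambda>t. (1 / t) *\<^sub>R u) \<longlongrightarrow> (1 / 1) *\<^sub>R u) (at_left (1::real))"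
      by (intro tendsto_intros) auto
    then have "eventually (\<lambda>t. (1 / t) *\<^sub>R u \<in> U) (at_left (1::real))"
      using \<open>open U\<close> u by (auto intro: topological_tendstoD)
    moreover have "eventually (\<lambda>t. t \<in> {0<..<1}) (at_left (1::real))"
      by (rule eventually_at_left_real) simp
    ultimately have "eventually (\<lambda>t. t \<in> S u \<and> t < 1) (at_left (1::real))"
      by eventually_elim (auto simp: S_def)
    then obtain t where "t \<in> S u" "t < 1"
      using eventually_happens[of _ "at_left (1::real)"] by auto
    then show ?thesis using p_le by force
  qed
  show thesis
  proof
    show "bounded_linear f"
      by (rule linear_le_norm_imp_bounded[OF f(1), of "1 / r"])
         (use order_trans[OF f(2) p_norm] in simp)
    fix x assume "x \<in> K"
    then have "k - x \<in> U" by (simp add: mem)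
    then have "f (k - x) < 1" using f(2)[of "k - x"] \<open>\<And>u. u \<in> U \<Longrightarrow> p u < 1\<close> by force
    then show "f x > 0" using \<open>1 \<le> p k\<close> f(3) linear_diff[OF f(1), of k x] by simp
  qed
qed

section \<open>The canonical embedding\<close>

lemma linear_canonical_embedding: "linear canonical_embedding"
  by (rule linearI; rule blinfun_eqI)
     (auto simp: blinfun.add_left blinfun.add_right blinfun.scaleR_left blinfun.scaleR_right)

lemma norm_canonical_embedding_le: "norm (canonical_embedding x) \<le> norm x"
proof (rule norm_blinfun_bound)
  show "norm (canonical_embedding x f) \<le> norm x * norm f" for f
    using norm_blinfun[of f x] by (simp add: mult.commute)
qed simp

lemma norm_canonical_embedding: "norm (canonical_embedding x) = norm x"
proof (rule antisym[OF norm_canonical_embedding_le])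
  obtain f where f: "norm f \<le> 1" "blinfun_apply f x = norm x" by (rule norming_functional)
  have "norm x = \<bar>canonical_embedding x f\<bar>" using f by simp
  also have "\<dots> \<le> norm (canonical_embedding x) * norm f"
    using norm_blinfun[of "canonical_embedding x" f] by simp
  also have "\<dots> \<le> norm (canonical_embedding x)" using f(1) by (simp add: mult_left_le)
  finally show "norm x \<le> norm (canonical_embedding x)" .
qed

lemma bounded_linear_canonical_embedding: "bounded_linear canonical_embedding"
  by (rule bounded_linear_intro[of _ 1])
     (auto simp: linear_add[OF linear_canonical_embedding] linear_scale[OF linear_canonical_embedding]
        norm_canonical_embedding_le)

section \<open>From the bidual back to the space\<close>

text \<open>
  No continuous functional separates \<open>h\<close> from \<open>C\<close>, not even weakly. The strict inequality
  makes the property stable under intersections of open convex sets, although the weak-star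
  closure of an intersection is in general smaller than the intersection of the closures.
\<close>

definition inside_bidual :: "'a::real_normed_vector bidual \<Rightarrow> 'a set \<Rightarrow> bool" where
  "inside_bidual h C \<longleftrightarrow> (\<forall>g. g \<noteq> 0 \<longrightarrow> (\<exists>c\<in>C. blinfun_apply h g < blinfun_apply g c))"

lemma inside_bidual_UNIV: "inside_bidual h UNIV"
  unfolding inside_bidual_def
proof (intro allI impI)
  fix g :: "'a dual" assume "g \<noteq> 0"
  then obtain x where x: "g x \<noteq> 0" by (metis blinfun_eqI zero_blinfun.rep_eq)
  have "h g < g (((h g + 1) / g x) *\<^sub>R x)" using x by (simp add: blinfun.scaleR_right)
  then show "\<exists>c\<in>UNIV. h g < g c" by blast
qed

text \<open>
  On the ball the supremum of \<open>g\<close> is \<open>c * norm g - g x\<close>, which exceeds \<open>h g\<close> because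
  \<open>g x + h g\<close> is at most \<open>norm (canonical_embedding x + h) * norm g < c * norm g\<close>.
\<close>

lemma inside_bidual_ball:
  fixes x :: "'a::real_normed_vector"
  assumes "norm (canonical_embedding x + h) < c"
  shows "inside_bidual h {y. norm (x + y) < c}"
  unfolding inside_bidual_def
proof (intro allI impI)
  fix g :: "'a dual" assume g: "g \<noteq> 0"
  define n where "n = norm (canonical_embedding x + h)"
  have n: "0 \<le> n" "n < c" using assms by (auto simp: n_def)
  have le: "g x + h g \<le> n * norm g"
    using norm_blinfun[of "canonical_embedding x + h" g]
    by (simp add: n_def blinfun.add_left)
  \<comment> \<open>If \<open>g z\<close> exceeds \<open>b * norm z\<close>, then scaling \<open>z\<close> to a norm slightly below \<open>c\<close>
      brings the value of \<open>g\<close> above \<open>n * norm g\<close>.\<close>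
  define b where "b = (n / c) * norm g"
  have "b < norm g" using n g by (simp add: b_def field_simps)
  have "\<exists>z. b * norm z < g z"
  proof (rule ccontr)
    assume "\<nexists>z. b * norm z < g z"
    then have *: "g z \<le> b * norm z" for z by (meson not_less)
    have "norm g \<le> b"
    proof (rule norm_blinfun_bound)
      show "0 \<le> b" using n by (simp add: b_def)
      show "norm (g z) \<le> b * norm z" for z
        using *[of z] *[of "- z"] by (simp add: blinfun.minus_right abs_le_iff)
    qed
    with \<open>b < norm g\<close> show False by simp
  qed
  then obtain z where z: "b * norm z < g z" by blast
  have "z \<noteq> 0" using z by auto
  have "\<exists>s>0. s * norm z < c \<and> n * norm g < s * g z"
  proof -
    have "0 \<le> b * norm z" using n by (simp add: b_def)
    then have gz: "g z > 0" using z by simp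
    have "n * norm g / g z < c / norm z"
      using z gz n \<open>z \<noteq> 0\<close> by (simp add: b_def field_simps)
    then obtain s where s: "n * norm g / g z < s" "s < c / norm z" using dense by blast
    have "0 \<le> n * norm g / g z" using n gz by simp
    with s have "0 < s" by simp
    with s show ?thesis using gz \<open>z \<noteq> 0\<close> by (intro exI[of _ s]) (auto simp: field_simps)
  qed
  then obtain s where s: "s > 0" "s * norm z < c" "n * norm g < s * g z" by blast
  show "\<exists>y\<in>{y. norm (x + y) < c}. h g < g y"
  proof (intro bexI CollectI)
    show "norm (x + (s *\<^sub>R z - x)) < c" using s by simp
    show "h g < g (s *\<^sub>R z - x)"
      using le s by (simp add: blinfun.diff_right blinfun.scaleR_right)
  qed
qed

text \<open>
  If the functional \<open>g\<close> were at most \<open>h g\<close> on \<open>C \<inter> D\<close>, then the origin would not be of the form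
  \<open>(d - c, g d - s)\<close> with \<open>s > h g\<close>. Separation yields functionals \<open>\<phi>\<close>, \<open>\<psi>\<close> and a number \<open>t\<close>
  with \<open>\<phi> + \<psi> + t *\<^sub>R g = 0\<close> and \<open>\<phi> c + \<psi> d + t * h g \<le> 0\<close> for all \<open>c \<in> C\<close>, \<open>d \<in> D\<close>.
  Points \<open>c\<close> and \<open>d\<close> with \<open>\<phi> c > h \<phi>\<close> and \<open>\<psi> d > h \<psi>\<close> contradict this, for \<open>h\<close> annihilates
  \<open>\<phi> + \<psi> + t *\<^sub>R g\<close>.
\<close>

lemma inside_bidual_Int:
  fixes h :: "'a::real_normed_vector bidual"
  assumes C: "open C" "convex C" "inside_bidual h C"
    and D: "open D" "convex D" "inside_bidual h D"
  shows "inside_bidual h (C \<inter> D)"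
  unfolding inside_bidual_def
proof (intro allI impI, rule ccontr)
  fix g :: "'a dual" assume g: "g \<noteq> 0" and neg: "\<not> (\<exists>c\<in>C \<inter> D. h g < g c)"
  define K where "K = {(d - c, g d - s) | c d s. c \<in> C \<and> d \<in> D \<and> h g < s}"
  have ne: "C \<noteq> {}" "D \<noteq> {}" using C(3) D(3) g by (auto simp: inside_bidual_def)
  have "open K"
  proof -
    have "K = (\<Union>d\<in>D. ((\<lambda>c. d - c) ` C) \<times> {..< g d - h g})"
    proof (rule set_eqI, clarify)
      fix a b
      have "(a, b) \<in> K \<longleftrightarrow> (\<exists>c d. c \<in> C \<and> d \<in> D \<and> a = d - c \<and> b < g d - h g)"
      proof
        assume "\<exists>c d. c \<in> C \<and> d \<in> D \<and> a = d - c \<and> b < g d - h g"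
        then obtain c d where "c \<in> C" "d \<in> D" "a = d - c" "h g < g d - b" by force
        then show "(a, b) \<in> K" unfolding K_def by (intro CollectI exI[of _ c] exI[of _ d] exI[of _ "g d - b"]) simp
      qed (auto simp: K_def)
      then show "(a, b) \<in> K \<longleftrightarrow> (a, b) \<in> (\<Union>d\<in>D. ((\<lambda>c. d - c) ` C) \<times> {..< g d - h g})"
        by auto
    qed
    moreover have "open ((\<lambda>c. d - c) ` C)" for d
      using open_translation[OF open_negations[OF C(1)], of d] by (simp add: image_image)
    ultimately show ?thesis by (auto intro!: open_Times)
  qed
  moreover have "convex K"
  proof (rule convexI)
    fix x y and u v :: real
    assume "x \<in> K" "y \<in> K" and uv: "0 \<le> u" "0 \<le> v" "u + v = 1"
    then obtain c d s c' d' s' where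
      x: "x = (d - c, g d - s)" "c \<in> C" "d \<in> D" "h g < s" and
      y: "y = (d' - c', g d' - s')" "c' \<in> C" "d' \<in> D" "h g < s'"
      unfolding K_def by blast
    have "u *\<^sub>R s + v *\<^sub>R s' \<in> {h g<..}"
      by (rule convexD) (use x(4) y(4) uv convex_real_interval(3) in auto)
    moreover have "u *\<^sub>R c + v *\<^sub>R c' \<in> C" "u *\<^sub>R d + v *\<^sub>R d' \<in> D"
      using x y uv C(2) D(2) by (auto intro: convexD)
    moreover have "u *\<^sub>R x + v *\<^sub>R y = ((u *\<^sub>R d + v *\<^sub>R d') - (u *\<^sub>R c + v *\<^sub>R c'),
        g (u *\<^sub>R d + v *\<^sub>R d') - (u *\<^sub>R s + v *\<^sub>R s'))"
      unfolding x(1) y(1)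
      by (simp add: blinfun.add_right blinfun.scaleR_right algebra_simps)
    ultimately show "u *\<^sub>R x + v *\<^sub>R y \<in> K"
      unfolding K_def greaterThan_iff by blast
  qed
  moreover have "0 \<notin> K" using neg by (auto simp: K_def zero_prod_def)
  moreover have "K \<noteq> {}"
  proof -
    obtain c d where "c \<in> C" "d \<in> D" using ne by auto
    then have "(d - c, g d - (h g + 1)) \<in> K" unfolding K_def by force
    then show ?thesis by auto
  qed
  ultimately obtain f where f: "bounded_linear f" "\<And>x. x \<in> K \<Longrightarrow> f x > (0::real)"
    using open_convex_positive_functional by metis
  define t where "t = f (0, 1)"
  have bl: "bounded_linear (\<lambda>y. f (y, 0))"
    by (intro bounded_linear_compose[OF f(1)] bounded_linear_Pair bounded_linear_ident bounded_linear_zero)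
  define \<phi> where "\<phi> = Blinfun (\<lambda>y. f (y, 0))"
  have \<phi>: "\<phi> y = f (y, 0)" for y by (simp add: \<phi>_def bounded_linear_Blinfun_apply[OF bl])
  have split: "f (y, b) = \<phi> y + b * t" for y b
  proof -
    have "f (y, b) = f ((y, 0) + b *\<^sub>R (0, 1))" by simp
    also have "\<dots> = \<phi> y + b * t"
      unfolding linear_add[OF bounded_linear.linear[OF f(1)]]
        linear_scale[OF bounded_linear.linear[OF f(1)]] by (simp add: \<phi> t_def)
    finally show ?thesis .
  qed
  define \<psi> where "\<psi> = - \<phi> - t *\<^sub>R g"
  have \<psi>: "\<psi> y = - \<phi> y - t * g y" for y
    by (simp add: \<psi>_def blinfun.diff_left blinfun.minus_left blinfun.scaleR_left)
  have key: "\<phi> c + \<psi> d + t * h g \<le> 0" if "c \<in> C" "d \<in> D" for c d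
  proof -
    have *: "\<phi> c + \<psi> d + t * s < 0" if "h g < s" for s
    proof -
      have "(d - c, g d - s) \<in> K" using \<open>c \<in> C\<close> \<open>d \<in> D\<close> that unfolding K_def by blast
      from f(2)[OF this] show ?thesis
        by (simp add: split \<psi> blinfun.diff_right algebra_simps)
    qed
    have "((\<lambda>s. \<phi> c + \<psi> d + t * s) \<longlongrightarrow> \<phi> c + \<psi> d + t * h g) (at_right (h g))"
      by (intro tendsto_intros)
    moreover have "eventually (\<lambda>s. \<phi> c + \<psi> d + t * s \<le> 0) (at_right (h g))"
      using * by (auto simp: eventually_at_right_less less_imp_le intro: eventually_mono[OF eventually_at_right_less])
    ultimately show ?thesis
      by (intro tendsto_upperbound) auto
  qed
  have h_sum: "h \<phi> + h \<psi> + t * h g = 0"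
    by (simp add: \<psi>_def blinfun.diff_right blinfun.minus_right blinfun.scaleR_right)
  have C': "\<exists>c\<in>C. h \<phi> \<le> \<phi> c \<and> (\<phi> \<noteq> 0 \<longrightarrow> h \<phi> < \<phi> c)"
    using C(3) ne(1) unfolding inside_bidual_def
    by (cases "\<phi> = 0") (simp, blast, metis less_imp_le)
  have D': "\<exists>d\<in>D. h \<psi> \<le> \<psi> d \<and> (\<psi> \<noteq> 0 \<longrightarrow> h \<psi> < \<psi> d)"
    using D(3) ne(2) unfolding inside_bidual_def
    by (cases "\<psi> = 0") (simp, blast, metis less_imp_le)
  from C' D' obtain c d where cd: "c \<in> C" "d \<in> D"
    "h \<phi> \<le> \<phi> c" "\<phi> \<noteq> 0 \<longrightarrow> h \<phi> < \<phi> c" "h \<psi> \<le> \<psi> d" "\<psi> \<noteq> 0 \<longrightarrow> h \<psi> < \<psi> d" by blast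
  \<comment> \<open>A strict inequality in one of the two places would already be a contradiction.\<close>
  have "\<phi> = 0" "\<psi> = 0" using key[OF cd(1,2)] h_sum cd(3-6) by force+
  then have "t = 0" using g by (simp add: \<psi>_def)
  then have "f x = 0" for x using split[of "fst x" "snd x"] \<open>\<phi> = 0\<close> by simp
  then show False using f(2) \<open>K \<noteq> {}\<close> by force
qed

text \<open>
  The conditions on \<open>y\<close> cut out an intersection of balls, and \<open>h\<close> is inside it. Testing this
  with a functional that almost norms \<open>h\<close> gives a point of large norm.
\<close>

lemma descend_from_bidual:
  fixes h :: "'a::real_normed_vector bidual"
  assumes "finite A" and lt: "\<And>x. x \<in> A \<Longrightarrow> norm (canonical_embedding x + h) < c"
    and r: "0 \<le> r" "r < norm h"
  obtains y where "\<And>x. x \<in> A \<Longrightarrow> norm (x + y) < c" "r < norm y"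
proof -
  have "open {y. \<forall>x\<in>A. norm (x + y) < c} \<and> convex {y. \<forall>x\<in>A. norm (x + y) < c}
      \<and> inside_bidual h {y. \<forall>x\<in>A. norm (x + y) < c}"
    using \<open>finite A\<close> lt
  proof (induction A rule: finite_induct)
    case empty
    then show ?case by (simp add: inside_bidual_UNIV)
  next
    case (insert x A)
    have eq: "{y. \<forall>z\<in>insert x A. norm (z + y) < c}
        = {y. norm (x + y) < c} \<inter> {y. \<forall>z\<in>A. norm (z + y) < c}" by auto
    have ball: "{y. norm (x + y) < c} = ball (- x) c"
      by (auto simp: dist_norm norm_minus_commute add.commute)
    have "open {y. norm (x + y) < c}" "convex {y. norm (x + y) < c}"
      unfolding ball by (rule open_ball, rule convex_ball)
    then show ?case unfolding eq using insert
      by (auto intro!: inside_bidual_Int inside_bidual_ball open_Int convex_Int)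
  qed
  then have inside: "inside_bidual h {y. \<forall>x\<in>A. norm (x + y) < c}" by blast
  have "\<exists>f. r * norm f < h f"
  proof (rule ccontr)
    assume "\<nexists>f. r * norm f < h f"
    then have *: "h f \<le> r * norm f" for f by (meson not_less)
    have "norm h \<le> r"
    proof (rule norm_blinfun_bound)
      show "norm (h f) \<le> r * norm f" for f
        using *[of f] *[of "- f"] by (simp add: blinfun.minus_right abs_le_iff)
    qed (use r in simp)
    with r show False by simp
  qed
  then obtain f where f: "r * norm f < h f" by blast
  then have "f \<noteq> 0" by auto
  then obtain y where y: "\<And>x. x \<in> A \<Longrightarrow> norm (x + y) < c" "h f < f y"
    using inside unfolding inside_bidual_def by blast
  have "r * norm f < norm f * norm y" using f y(2) norm_blinfun[of f y] by simp
  then have "r < norm y" using \<open>f \<noteq> 0\<close> by (simp add: mult.commute)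
  with y(1) show thesis by (rule that)
qed

section \<open>Elements of the fourth dual force almost squareness\<close>

text \<open>
  The origin is included in the finite set in order to bound the norm of the vector obtained, and
  the negatives in order to cover both signs. Two descents leave a vector \<open>y\<close> with norm in
  the interval from \<open>1 - \<delta>\<close> to \<open>1 + \<delta>\<close>, and normalizing it costs another \<open>\<delta>\<close>.
\<close>

lemma fourth_dual_element_imp_almost_square:
  fixes h :: "'a::banach bidual bidual"
  assumes "h \<noteq> 0"
    and max: "\<And>x :: 'a. norm (canonical_embedding (canonical_embedding x) + h) = max (norm x) (norm h)"
  shows "almost_square TYPE('a)"
  unfolding almost_square_def
proof (intro allI impI)
  fix \<epsilon> :: real and A :: "'a set"
  assume \<epsilon>: "\<epsilon> > 0" and A: "A \<subseteq> sphere 0 1" "finite A"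
  define H where "H = (1 / norm h) *\<^sub>R h"
  have H: "norm H = 1" using \<open>h \<noteq> 0\<close> by (simp add: H_def)
  have max1: "norm (canonical_embedding (canonical_embedding x) + H) = max (norm x) 1" for x :: 'a
  proof -
    have "canonical_embedding (canonical_embedding x) + H
        = (1 / norm h) *\<^sub>R (canonical_embedding (canonical_embedding (norm h *\<^sub>R x)) + h)"
      using \<open>h \<noteq> 0\<close>
      by (simp add: H_def linear_scale[OF linear_canonical_embedding] algebra_simps)
    then have "norm (canonical_embedding (canonical_embedding x) + H)
        = max (norm (norm h *\<^sub>R x)) (norm h) / norm h"
      by (simp only: norm_scaleR max) simp
    also have "\<dots> = max (norm x) 1"
      using \<open>h \<noteq> 0\<close> by (simp add: max_def field_simps)
    finally show ?thesis .
  qed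
  define \<delta> where "\<delta> = min (\<epsilon> / 2) (1 / 2)"
  have \<delta>: "0 < \<delta>" "\<delta> < 1" "2 * \<delta> \<le> \<epsilon>" using \<epsilon> by (auto simp: \<delta>_def)
  define B where "B = insert 0 (A \<union> uminus ` A)"
  have B: "finite B" "\<And>x. x \<in> B \<Longrightarrow> norm x \<le> 1" using A by (auto simp: B_def)
  obtain k :: "'a bidual" where k: "\<And>x. x \<in> canonical_embedding ` B \<Longrightarrow> norm (x + k) < 1 + \<delta>"
    "1 - \<delta> < norm k"
  proof (rule descend_from_bidual[of "canonical_embedding ` B" H "1 + \<delta>" "1 - \<delta>"])
    show "norm (canonical_embedding x + H) < 1 + \<delta>" if "x \<in> canonical_embedding ` B" for x
      using that B(2) \<delta> by (auto simp: max1 max_def)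
  qed (use B \<delta> H in auto)
  obtain y where y: "\<And>x. x \<in> B \<Longrightarrow> norm (x + y) < 1 + \<delta>" "1 - \<delta> < norm y"
    by (rule descend_from_bidual[of B k "1 + \<delta>" "1 - \<delta>"]) (use B k \<delta> in auto)
  have "norm y < 1 + \<delta>" using y(1)[of 0] by (simp add: B_def)
  have "y \<noteq> 0" using y(2) \<delta> by auto
  have sgn: "norm (sgn y - y) \<le> \<delta>"
  proof -
    have "sgn y - y = (1 - norm y) *\<^sub>R sgn y"
      using \<open>y \<noteq> 0\<close> by (simp add: sgn_div_norm algebra_simps)
    then show ?thesis using \<open>y \<noteq> 0\<close> \<open>norm y < 1 + \<delta>\<close> y(2) by (simp add: norm_sgn abs_le_iff)
  qed
  have plus: "norm (x + sgn y) \<le> 1 + \<epsilon>" if "x \<in> B" for x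
    using norm_triangle_ineq[of "x + y" "sgn y - y"] sgn y(1)[OF that] \<delta> by simp
  show "\<exists>h\<in>sphere 0 1. \<forall>x\<in>A. norm (x + h) \<le> 1 + \<epsilon> \<and> norm (x - h) \<le> 1 + \<epsilon>"
  proof (intro bexI ballI conjI)
    show "sgn y \<in> sphere 0 1" using \<open>y \<noteq> 0\<close> by (simp add: norm_sgn)
    fix x assume "x \<in> A"
    then show "norm (x + sgn y) \<le> 1 + \<epsilon>" by (intro plus) (simp add: B_def)
    have "norm (- x + sgn y) \<le> 1 + \<epsilon>" using \<open>x \<in> A\<close> by (intro plus) (simp add: B_def)
    then show "norm (x - sgn y) \<le> 1 + \<epsilon>" by (simp add: norm_minus_commute)
  qed
qed

section \<open>Generalized limits\<close>

text \<open>
  The condition says that \<open>k f\<close> is at most the limit superior of \<open>f (g n)\<close>, so that, applied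
  to \<open>f\<close> and \<open>- f\<close>, it places \<open>k f\<close> between the limits inferior and superior. Every weak-star
  cluster point of \<open>g\<close> in the bidual has this property.
\<close>

definition generalized_limit :: "(nat \<Rightarrow> 'a::real_normed_vector) \<Rightarrow> 'a bidual \<Rightarrow> bool" where
  "generalized_limit g k \<longleftrightarrow>
    (\<forall>f c. eventually (\<lambda>n. blinfun_apply f (g n) \<le> c) sequentially \<longrightarrow> blinfun_apply k f \<le> c)"

lemma generalized_limit_le:
  "generalized_limit g k \<Longrightarrow> eventually (\<lambda>n. blinfun_apply f (g n) \<le> c) sequentially
    \<Longrightarrow> blinfun_apply k f \<le> c"
  by (auto simp: generalized_limit_def)

lemma generalized_limit_ge:
  assumes "generalized_limit g k" "eventually (\<lambda>n. c \<le> blinfun_apply f (g n)) sequentially"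
  shows "c \<le> blinfun_apply k f"
  using generalized_limit_le[OF assms(1), of "- f" "- c"] assms(2)
  by (simp add: blinfun.minus_left blinfun.minus_right)

text \<open>
  The limit superior of \<open>f (g n)\<close> is a sublinear function of \<open>f\<close>, and any linear functional
  below it is a generalized limit.
\<close>

lemma generalized_limit_exists:
  fixes g :: "nat \<Rightarrow> 'a::real_normed_vector"
  assumes B: "\<And>n. norm (g n) \<le> B"
  obtains k where "generalized_limit g k"
proof -
  define S where "S f = {c. eventually (\<lambda>n. blinfun_apply f (g n) \<le> c) sequentially}" for f :: "'a dual"
  define p where "p f = Inf (S f)" for f
  have fg: "\<bar>blinfun_apply f (g n)\<bar> \<le> norm f * B" for f n
    using norm_blinfun[of f "g n"] mult_left_mono[OF B[of n] norm_ge_zero[of f]] by simp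
  have S_mem: "norm f * B \<in> S f" for f
    unfolding S_def using fg[of f] by (auto simp: abs_le_iff)
  have lower: "- (norm f * B) \<le> c" if "c \<in> S f" for f c
  proof -
    have "\<exists>n. blinfun_apply f (g n) \<le> c"
      using that eventually_happens[of _ sequentially] by (auto simp: S_def)
    then show ?thesis using fg[of f] by (metis abs_le_iff minus_le_iff order_trans)
  qed
  have bdd: "bdd_below (S f)" for f by (rule bdd_belowI) (rule lower)
  have p_le: "p f \<le> c" if "c \<in> S f" for f c unfolding p_def using that bdd by (rule cInf_lower)
  have p_ge: "b \<le> p f" if "\<And>c. c \<in> S f \<Longrightarrow> b \<le> c" for b f
    unfolding p_def using that S_mem[of f] by (intro cInf_greatest) auto
  have "sublinear p"
  proof (rule sublinearI)
    fix x y
    have *: "a + b \<in> S (x + y)" if "a \<in> S x" "b \<in> S y" for a b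
      using that unfolding S_def mem_Collect_eq
      by eventually_elim (simp add: blinfun.add_left)
    have "p (x + y) - a \<le> p y" if a: "a \<in> S x" for a
      by (rule p_ge) (use p_le[OF *[OF a]] in \<open>force simp: algebra_simps\<close>)
    then have "p (x + y) - p y \<le> p x" by (intro p_ge) (simp add: algebra_simps)
    then show "p (x + y) \<le> p x + p y" by simp
  next
    have "S 0 = {0..}" by (auto simp: S_def)
    then show "p 0 = 0" by (simp add: p_def)
  next
    fix t :: real and f assume t: "t > 0"
    have "p (t *\<^sub>R f) / t \<le> p f"
    proof (rule p_ge)
      fix c assume "c \<in> S f"
      then have "t * c \<in> S (t *\<^sub>R f)" using t by (simp add: S_def blinfun.scaleR_left)
      from p_le[OF this] show "p (t *\<^sub>R f) / t \<le> c" using t by (simp add: field_simps)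
    qed
    then show "p (t *\<^sub>R f) \<le> t * p f" using t by (simp add: field_simps)
  qed
  then obtain k where k: "linear k" "\<And>f. k f \<le> p f" by (rule sublinear_dominates_linear) blast
  have bl: "bounded_linear k"
    using order_trans[OF k(2) p_le[OF S_mem]] by (rule linear_le_norm_imp_bounded[OF k(1)])
  have "generalized_limit g (Blinfun k)"
    unfolding generalized_limit_def bounded_linear_Blinfun_apply[OF bl]
    using order_trans[OF k(2) p_le] by (auto simp: S_def)
  then show thesis by (rule that)
qed

lemma norm_add_generalized_limit_le:
  assumes k: "generalized_limit g k" and ev: "eventually (\<lambda>n. norm (x + g n) \<le> C) sequentially"
  shows "norm (canonical_embedding x + k) \<le> C"
proof (rule norm_blinfun_bound)
  show "0 \<le> C" using eventually_happens[OF ev] by (auto intro: order_trans[OF norm_ge_zero])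
  have *: "(canonical_embedding x + k) f \<le> C * norm f" for f
  proof -
    have "eventually (\<lambda>n. blinfun_apply f (g n) \<le> C * norm f - blinfun_apply f x) sequentially"
      using ev
    proof eventually_elim
      case (elim n)
      have "blinfun_apply f (x + g n) \<le> norm f * norm (x + g n)"
        using norm_blinfun[of f "x + g n"] by simp
      also have "\<dots> \<le> C * norm f" using elim mult_left_mono[OF elim norm_ge_zero[of f]] by (simp add: mult.commute)
      finally show ?case by (simp add: blinfun.add_right)
    qed
    from generalized_limit_le[OF k this] show ?thesis by (simp add: blinfun.add_left)
  qed
  show "norm ((canonical_embedding x + k) f) \<le> C * norm f" for f
    using *[of f] *[of "- f"] by (simp add: blinfun.minus_right abs_le_iff)
qed

lemma norm_generalized_limit_le:
  assumes "generalized_limit g k" "eventually (\<lambda>n. norm (g n) \<le> C) sequentially"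
  shows "norm k \<le> C"
  using norm_add_generalized_limit_le[of g k 0 C] assms
  by (simp add: linear_0[OF linear_canonical_embedding])

section \<open>Sequences with bounded signed sums in almost square spaces\<close>

text \<open>
  The estimate on the sphere extends to all vectors by convexity: inside the unit ball, \<open>y + h\<close>
  lies on the segment between \<open>sgn y + h\<close> and \<open>h\<close>; outside it, \<open>y + h\<close> differs from
  \<open>sgn y + h\<close> by a vector of norm \<open>norm y - 1\<close>.
\<close>

lemma almost_square_max:
  fixes A :: "'a::banach set"
  assumes asq: "almost_square TYPE('a)" and "finite A" "\<epsilon> > 0"
  obtains h where "norm h = 1" "\<And>y. y \<in> A \<Longrightarrow> norm (y + h) \<le> max (norm y) 1 + \<epsilon>"
    "\<And>y. y \<in> A \<Longrightarrow> norm (y - h) \<le> max (norm y) 1 + \<epsilon>"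
proof -
  have A: "finite (sgn ` (A - {0}))" "sgn ` (A - {0}) \<subseteq> sphere 0 1"
    using \<open>finite A\<close> by (auto simp: norm_sgn split: if_splits)
  obtain h where h: "norm h = 1"
    and hA: "\<And>y. y \<in> A \<Longrightarrow> y \<noteq> 0 \<Longrightarrow> norm (sgn y + h) \<le> 1 + \<epsilon> \<and> norm (sgn y - h) \<le> 1 + \<epsilon>"
  proof -
    obtain h where h: "h \<in> sphere 0 1"
      "\<forall>x\<in>sgn ` (A - {0}). norm (x + h) \<le> 1 + \<epsilon> \<and> norm (x - h) \<le> 1 + \<epsilon>"
      using asq[unfolded almost_square_def, rule_format, OF \<open>\<epsilon> > 0\<close> A(2) A(1)] by (elim bexE)
    show thesis
    proof (rule that[of h])
      show "norm h = 1" using h(1) by simp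
      show "norm (sgn y + h) \<le> 1 + \<epsilon> \<and> norm (sgn y - h) \<le> 1 + \<epsilon>" if "y \<in> A" "y \<noteq> 0" for y
        using h(2) that by blast
    qed
  qed
  have *: "norm (y + e) \<le> max (norm y) 1 + \<epsilon>"
    if y: "y \<noteq> 0" and e: "norm e = 1" "norm (sgn y + e) \<le> 1 + \<epsilon>" for y e :: 'a
  proof (cases "norm y \<le> 1")
    case True
    have "y + e = norm y *\<^sub>R (sgn y + e) + (1 - norm y) *\<^sub>R e"
      using y by (simp add: sgn_div_norm algebra_simps)
    also have "norm \<dots> \<le> norm y * norm (sgn y + e) + (1 - norm y) * norm e"
      using True norm_triangle_ineq[of "norm y *\<^sub>R (sgn y + e)" "(1 - norm y) *\<^sub>R e"] by simp
    also have "\<dots> \<le> norm y * (1 + \<epsilon>) + (1 - norm y)"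
      using e by (simp add: mult_left_mono)
    also have "\<dots> \<le> 1 + \<epsilon>" using True \<open>\<epsilon> > 0\<close> by (simp add: algebra_simps)
    finally show ?thesis using True by simp
  next
    case False
    have "y + e = (norm y - 1) *\<^sub>R sgn y + (sgn y + e)"
      using y by (simp add: sgn_div_norm algebra_simps)
    also have "norm \<dots> \<le> (norm y - 1) + norm (sgn y + e)"
      using False y norm_triangle_ineq[of "(norm y - 1) *\<^sub>R sgn y" "sgn y + e"]
      by (simp add: norm_sgn)
    finally show ?thesis using e by simp
  qed
  show thesis
  proof
    show "norm h = 1" by fact
    fix y assume "y \<in> A"
    then show "norm (y + h) \<le> max (norm y) 1 + \<epsilon>" "norm (y - h) \<le> max (norm y) 1 + \<epsilon>"
      using *[of y h] *[of y "- h"] hA[of y] h \<open>\<epsilon> > 0\<close> by (cases "y = 0"; simp)+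
  qed
qed

text \<open>
  The vector \<open>h n\<close> is chosen with error \<open>1 / 2 ^ n\<close> with respect to the finitely many signed sums
  formed before; the errors from \<open>n\<close> on add up to \<open>2 / 2 ^ n\<close>.
\<close>

lemma almost_square_c0_sequence:
  fixes d :: "nat \<Rightarrow> 'a::banach"
  assumes asq: "almost_square TYPE('a)" and d: "\<And>i. norm (d i) \<le> 1"
  obtains h where "\<And>n. norm (h n) = 1"
    "\<And>y \<sigma> n m. y = 0 \<or> y \<in> d ` {..<n} \<Longrightarrow> n \<le> m \<Longrightarrow> (\<And>i. \<sigma> i \<in> {-1, 1 :: real})
        \<Longrightarrow> norm (y + (\<Sum>i\<in>{n..<m}. \<sigma> i *\<^sub>R h i)) \<le> 1 + 2 / 2 ^ n"
proof -
  \<comment> \<open>\<open>G n\<close> is the finite set of vectors that the choice of \<open>h n\<close> has to respect.\<close>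
  define Q where "Q n G h G' \<longleftrightarrow> norm h = 1 \<and> insert (d n) G \<subseteq> G' \<and>
     (\<forall>y\<in>G. \<forall>s\<in>{-1, 1}. y + s *\<^sub>R h \<in> G' \<and> norm (y + s *\<^sub>R h) \<le> max (norm y) 1 + 1 / 2 ^ n)"
     for n :: nat and G G' :: "'a set" and h
  have step: "\<exists>G'. (finite G' \<and> 0 \<in> G') \<and> (\<exists>h. Q n G h G')" if G: "finite G \<and> 0 \<in> G" for G n
  proof -
    obtain h where h: "norm h = 1" "\<And>y. y \<in> G \<Longrightarrow> norm (y + h) \<le> max (norm y) 1 + 1 / 2 ^ n"
      "\<And>y. y \<in> G \<Longrightarrow> norm (y - h) \<le> max (norm y) 1 + 1 / 2 ^ n"
      using almost_square_max[OF asq, of G "1 / 2 ^ n"] G by auto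
    define G' where "G' = insert (d n) (G \<union> (\<lambda>y. y + h) ` G \<union> (\<lambda>y. y - h) ` G)"
    have "finite G' \<and> 0 \<in> G'" using G by (auto simp: G'_def)
    moreover have "Q n G h G'" using h by (auto simp: Q_def G'_def)
    ultimately show ?thesis by blast
  qed
  have "\<exists>G. \<forall>n. (finite (G n) \<and> 0 \<in> G n) \<and> (\<exists>h. Q n (G n) h (G (Suc n)))"
  proof (rule dependent_nat_choice)
    show "\<exists>G :: 'a set. finite G \<and> 0 \<in> G" by (rule exI[of _ "{0}"]) simp
  qed (rule step)
  then obtain G h where G0: "\<And>n. 0 \<in> G n" and Q: "\<And>n. Q n (G n) (h n) (G (Suc n))" by metis
  have mono: "G n \<subseteq> G (Suc n)" for n using Q[of n] by (auto simp: Q_def)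
  have dG: "d i \<in> G n" if "i < n" for i n
  proof -
    have "d i \<in> G (Suc i)" using Q[of i] by (auto simp: Q_def)
    then show ?thesis using lift_Suc_mono_le[of G "Suc i" n, OF mono] that by auto
  qed
  have signed: "y + (\<Sum>i\<in>{n..<m}. \<sigma> i *\<^sub>R h i) \<in> G m \<and>
      norm (y + (\<Sum>i\<in>{n..<m}. \<sigma> i *\<^sub>R h i)) \<le> 1 + (2 / 2 ^ n - 2 / 2 ^ m)"
    if "n \<le> m" and y: "y \<in> G n" "norm y \<le> 1" and \<sigma>: "\<And>i. \<sigma> i \<in> {-1, 1}" for y n m and \<sigma> :: "nat \<Rightarrow> real"
    using \<open>n \<le> m\<close>
  proof (induction m rule: dec_induct)
    case base
    then show ?case using y by simp
  next
    case (step m)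
    define z where "z = y + (\<Sum>i\<in>{n..<m}. \<sigma> i *\<^sub>R h i)"
    have eq: "y + (\<Sum>i\<in>{n..<Suc m}. \<sigma> i *\<^sub>R h i) = z + \<sigma> m *\<^sub>R h m"
      using step.hyps by (simp add: z_def algebra_simps)
    have z: "z \<in> G m" "norm z \<le> 1 + (2 / 2 ^ n - 2 / 2 ^ m)" using step.IH by (auto simp: z_def)
    have "2 / 2 ^ m \<le> (2 / 2 ^ n :: real)" using step.hyps by (simp add: field_simps)
    then have "max (norm z) 1 \<le> 1 + (2 / 2 ^ n - 2 / 2 ^ m)" using z by simp
    moreover have "z + \<sigma> m *\<^sub>R h m \<in> G (Suc m)"
      "norm (z + \<sigma> m *\<^sub>R h m) \<le> max (norm z) 1 + 1 / 2 ^ m"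
      using Q[of m] z \<sigma>[of m] by (auto simp: Q_def)
    moreover have "1 / 2 ^ m + 2 / 2 ^ Suc m = 2 / (2 :: real) ^ m" by simp
    ultimately show ?case unfolding eq by linarith
  qed
  show thesis
  proof
    show "norm (h n) = 1" for n using Q[of n] by (simp add: Q_def)
    fix y and \<sigma> :: "nat \<Rightarrow> real" and n m :: nat
    assume y: "y = 0 \<or> y \<in> d ` {..<n}" and nm: "n \<le> m" and \<sigma>: "\<And>i. \<sigma> i \<in> {-1, 1::real}"
    have "y \<in> G n" "norm y \<le> 1" using y G0 dG d by auto
    then have "norm (y + (\<Sum>i\<in>{n..<m}. \<sigma> i *\<^sub>R h i)) \<le> 1 + (2 / 2 ^ n - 2 / 2 ^ m)"
      using signed[OF nm, of y \<sigma>] \<sigma> by blast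
    also have "\<dots> \<le> 1 + 2 / 2 ^ n" by simp
    finally show "norm (y + (\<Sum>i\<in>{n..<m}. \<sigma> i *\<^sub>R h i)) \<le> 1 + 2 / 2 ^ n" .
  qed
qed

section \<open>The element of the fourth dual\<close>

text \<open>
  A dense sequence of the whole space, retracted radially onto the unit ball.
\<close>

lemma separable_unit_ball_dense_sequence:
  assumes "separable_space (euclidean :: 'a::real_normed_vector topology)"
  obtains d :: "nat \<Rightarrow> 'a::real_normed_vector" where "\<And>i. norm (d i) \<le> 1" "cball 0 1 \<subseteq> closure (range d)"
proof -
  obtain D :: "'a set" where D: "countable D" "closure D = UNIV"
    using assms by (auto simp: separable_space_def)
  have "D \<noteq> {}" using D(2) by auto
  define r where "r x = inverse (max 1 (norm x)) *\<^sub>R x" for x :: 'a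
  have cont: "continuous_on UNIV r"
    unfolding r_def by (intro continuous_intros) auto
  define d where "d i = r (from_nat_into D i)" for i
  have range: "range d = r ` D"
    using range_from_nat_into[OF \<open>D \<noteq> {}\<close> D(1)] by (auto simp: d_def image_iff) (metis rangeE)+
  have "r ` closure D \<subseteq> closure (r ` D)"
    by (rule image_closure_subset[of _ r]) (auto intro: continuous_on_subset[OF cont] closure_subset[THEN subsetD])
  moreover have "x = r x" if "norm x \<le> 1" for x using that by (simp add: r_def max_def)
  ultimately have "cball 0 1 \<subseteq> closure (range d)"
    unfolding range D(2) by (force simp: dist_norm)
  moreover have "norm (d i) \<le> 1" for i
    unfolding d_def r_def by (auto simp: field_simps max_def)
  ultimately show thesis using that by blast
qed

text \<open>
  Outside the unit ball the upper estimate follows from the triangle inequality, with \<open>x\<close> split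
  into \<open>sgn x\<close> and a remainder. The lower one follows from the upper one for \<open>- x\<close>, since
  \<open>T x + h\<close> and \<open>T x - h\<close> add up to \<open>2 *\<^sub>R T x\<close>.
\<close>

lemma max_norm_if_unit_ball:
  fixes T :: "'a::real_normed_vector \<Rightarrow> 'b::real_normed_vector"
  assumes T: "linear T" "\<And>x. norm (T x) = norm x"
    and upper: "\<And>x. norm x \<le> 1 \<Longrightarrow> norm (T x + h) \<le> 1"
    and lower: "\<And>x. 1 \<le> norm (T x + h)"
  shows "norm (T x + h) = max (norm x) 1"
proof (cases "norm x \<le> 1")
  case True
  then show ?thesis using upper[of x] lower[of x] by simp
next
  case False
  then have "x \<noteq> 0" by auto
  have ge1: "norm (T x + h) \<le> norm x" if "1 < norm x" for x
  proof -
    have x: "x = (norm x - 1) *\<^sub>R sgn x + sgn x"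
      using that \<open>1 < norm x\<close> by (cases "x = 0") (auto simp: sgn_div_norm algebra_simps)
    have "T x + h = (norm x - 1) *\<^sub>R T (sgn x) + (T (sgn x) + h)"
      by (subst x) (simp only: linear_add[OF T(1)] linear_scale[OF T(1)] add.assoc)
    also have "norm \<dots> \<le> norm ((norm x - 1) *\<^sub>R T (sgn x)) + norm (T (sgn x) + h)"
      by (rule norm_triangle_ineq)
    also have "\<dots> \<le> (norm x - 1) * 1 + 1"
      using that T(2)[of "sgn x"] upper[of "sgn x"]
      by (intro add_mono) (auto simp: norm_sgn split: if_splits)
    finally show ?thesis by simp
  qed
  have "2 * norm x \<le> norm (T x + h) + norm (T x - h)"
    using norm_triangle_ineq[of "T x + h" "T x - h"] T(2)[of x]
    by (simp flip: scaleR_2)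
  moreover have "norm (T x - h) = norm (T (- x) + h)"
    by (simp add: linear_neg[OF T(1)] norm_minus_commute)
  ultimately show ?thesis using ge1[of x] ge1[of "- x"] False by simp
qed

text \<open>
  The functional \<open>\<Phi>\<close> in the third dual, a limit of functionals \<open>f j\<close> norming at \<open>e j\<close>, detects
  \<open>h\<close> and vanishes on the space. It gives the lower estimate of the norm of \<open>x + h\<close>.
\<close>

lemma almost_square_imp_fourth_dual_element:
  assumes sep: "separable_space (euclidean :: 'a::banach topology)"
    and asq: "almost_square TYPE('a)"
  obtains h :: "'a::banach bidual bidual"
  where "\<And>x :: 'a. norm (canonical_embedding (canonical_embedding x) + h) = max (norm x) 1"
proof -
  obtain d :: "nat \<Rightarrow> 'a" where d: "\<And>i. norm (d i) \<le> 1" "cball 0 1 \<subseteq> closure (range d)"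
    using separable_unit_ball_dense_sequence[OF sep] by blast
  obtain e :: "nat \<Rightarrow> 'a" where e: "\<And>n. norm (e n) = 1"
    and signed: "\<And>y \<sigma> n m. y = 0 \<or> y \<in> d ` {..<n} \<Longrightarrow> n \<le> m \<Longrightarrow> (\<And>i. \<sigma> i \<in> {-1, 1 :: real})
        \<Longrightarrow> norm (y + (\<Sum>i\<in>{n..<m}. \<sigma> i *\<^sub>R e i)) \<le> 1 + 2 / 2 ^ n"
    using almost_square_c0_sequence[OF asq, of d] d(1) by blast
  define S where "S n m = (\<Sum>i\<in>{n..<m}. e i)" for n m
  have S: "norm (y + S n m) \<le> 1 + 2 / 2 ^ n" if "y = 0 \<or> y \<in> d ` {..<n}" "n \<le> m" for y n m
    using signed[OF that, of "\<lambda>_. 1"] by (simp add: S_def)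
  have small: "eventually (\<lambda>n. 2 / 2 ^ n \<le> \<delta>) sequentially" if "\<delta> > 0" for \<delta> :: real
  proof -
    have "(\<lambda>n. 2 / 2 ^ n :: real) \<longlonglongrightarrow> 0"
      using tendsto_mult[OF tendsto_const[of 2] LIMSEQ_power_zero[of "1 / 2 :: real"]]
      by (simp add: power_divide)
    then have "eventually (\<lambda>n. 2 / 2 ^ n < \<delta>) sequentially" by (rule order_tendstoD) (rule that)
    then show ?thesis by (rule eventually_mono) simp
  qed
  have "\<exists>k. generalized_limit (S n) k" for n
  proof -
    have "norm (S n m) \<le> 1 + 2 / 2 ^ n" for m
      using S[of 0 n m] by (cases "n \<le> m") (auto simp: S_def)
    then show ?thesis using generalized_limit_exists by metis
  qed
  then obtain k where k: "\<And>n. generalized_limit (S n) (k n)" by metis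
  have k_norm: "norm (canonical_embedding y + k n) \<le> 1 + 2 / 2 ^ n"
    if "y = 0 \<or> y \<in> d ` {..<n}" for y n
    by (rule norm_add_generalized_limit_le[OF k])
       (use S[OF that] in \<open>auto simp: eventually_sequentially\<close>)
  have "norm (k n) \<le> 3" for n
  proof -
    have "2 / 2 ^ n \<le> (2 :: real)" by (simp add: field_simps)
    then show ?thesis
      using k_norm[of 0 n] by (simp add: linear_0[OF linear_canonical_embedding])
  qed
  then obtain h where h: "generalized_limit k h" using generalized_limit_exists by metis
  have "\<exists>f :: 'a dual. norm f \<le> 1 \<and> blinfun_apply f (e j) = 1" for j
    using norming_functional[of "e j"] e by metis
  then obtain f :: "nat \<Rightarrow> 'a dual" where f: "\<And>j. norm (f j) \<le> 1" "\<And>j. blinfun_apply (f j) (e j) = 1" by metis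
  obtain \<Phi> where \<Phi>: "generalized_limit f \<Phi>" using generalized_limit_exists[of f 1] f(1) by blast
  have \<Phi>_norm: "norm \<Phi> \<le> 1" using f(1) by (intro norm_generalized_limit_le[OF \<Phi>]) simp
  have f_le: "f j x \<le> norm x" for j x
    using norm_blinfun[of "f j" x] mult_right_mono[OF f(1)[of j] norm_ge_zero[of x]] by simp

  \<comment> \<open>Reversing all signs in \<open>S n m\<close> except that of \<open>e j\<close> gives \<open>2 *\<^sub>R e j - S n m\<close>,
      where \<open>f j\<close> has the value \<open>2 - f j (S n m)\<close>, which the norm bounds.\<close>
  have f_S: "1 - 2 / 2 ^ n \<le> f j (S n m)" if "n \<le> j" "j < m" for n j m
  proof -
    have "(\<Sum>i\<in>{n..<m}. (if i = j then 1 else -1) *\<^sub>R e i)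
        = (\<Sum>i\<in>{n..<m}. (if i = j then 2 *\<^sub>R e i else 0) - e i)"
      by (intro sum.cong) (auto simp: scaleR_2)
    also have "\<dots> = 2 *\<^sub>R e j - S n m"
      using that by (simp add: sum_subtractf S_def)
    finally have "norm (2 *\<^sub>R e j - S n m) \<le> 1 + 2 / 2 ^ n"
      using signed[of 0 n m "\<lambda>i. if i = j then 1 else -1"] that by simp
    then show ?thesis
      using f_le[of j "2 *\<^sub>R e j - S n m"] f(2)[of j]
      by (simp add: blinfun.diff_right blinfun.scaleR_right)
  qed
  have "1 - 2 / 2 ^ n \<le> k n (f j)" if "n \<le> j" for n j
    by (rule generalized_limit_ge[OF k])
       (use f_S[OF that] in \<open>auto simp: eventually_sequentially intro!: exI[of _ "Suc j"]\<close>)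
  then have \<Phi>_k: "1 - 2 / 2 ^ n \<le> \<Phi> (k n)" for n
    by (intro generalized_limit_ge[OF \<Phi>]) (auto simp: eventually_sequentially)
  have h_\<Phi>: "1 \<le> h \<Phi>"
  proof (rule field_le_epsilon)
    fix \<delta> :: real assume "\<delta> > 0"
    have "eventually (\<lambda>n. 1 - \<delta> \<le> \<Phi> (k n)) sequentially"
      using small[OF \<open>\<delta> > 0\<close>]
    proof eventually_elim
      case (elim n)
      then show ?case using \<Phi>_k[of n] by simp
    qed
    from generalized_limit_ge[OF h this] show "1 \<le> h \<Phi> + \<delta>" by simp
  qed

  \<comment> \<open>Both \<open>d i + e j\<close> and \<open>- d i + e j\<close> have norm close to one, which \<open>f j\<close> attains at
      \<open>e j\<close> already, so that nothing is left for \<open>d i\<close>.\<close>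
  have f_d: "\<bar>f j (d i)\<bar> \<le> 2 / 2 ^ j" if "i < j" for i j
  proof -
    have "norm (d i + s *\<^sub>R e j) \<le> 1 + 2 / 2 ^ j" if "s \<in> {-1, 1}" for s
      using signed[of "d i" j "Suc j" "\<lambda>_. s"] \<open>i < j\<close> that by simp
    from this[of 1] this[of "-1"]
    have "norm (d i + e j) \<le> 1 + 2 / 2 ^ j" "norm (- d i + e j) \<le> 1 + 2 / 2 ^ j"
      by (simp_all add: norm_minus_commute)
    then show ?thesis
      using f_le[of j "d i + e j"] f_le[of j "- d i + e j"] f(2)[of j]
      by (simp add: blinfun.add_right blinfun.diff_right blinfun.minus_right abs_le_iff)
  qed
  have \<Phi>_d: "\<Phi> (canonical_embedding (d i)) = 0" for i
  proof -
    have ev: "eventually (\<lambda>j. \<bar>canonical_embedding (d i) (f j)\<bar> \<le> \<delta>) sequentially"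
      if "\<delta> > 0" for \<delta>
      using small[OF that] eventually_gt_at_top[of i]
    proof eventually_elim
      case (elim j)
      then show ?case using f_d[of i j] by simp
    qed
    show ?thesis
    proof (rule antisym; rule field_le_epsilon)
      fix \<delta> :: real assume "\<delta> > 0"
      show "\<Phi> (canonical_embedding (d i)) \<le> 0 + \<delta>"
        by (rule generalized_limit_le[OF \<Phi>], rule eventually_mono[OF ev[OF \<open>\<delta> > 0\<close>]]) simp
      have "- \<delta> \<le> \<Phi> (canonical_embedding (d i))"
        by (rule generalized_limit_ge[OF \<Phi>], rule eventually_mono[OF ev[OF \<open>\<delta> > 0\<close>]]) simp
      then show "0 \<le> \<Phi> (canonical_embedding (d i)) + \<delta>" by simp
    qed
  qed

  let ?J = "\<lambda>x :: 'a. canonical_embedding (canonical_embedding x)"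
  have cont_J: "continuous_on UNIV (canonical_embedding :: 'a \<Rightarrow> 'a bidual)" 
    "continuous_on UNIV ?J"
    by (auto intro!: linear_continuous_on bounded_linear_compose[OF bounded_linear_canonical_embedding]
        bounded_linear_canonical_embedding)
  have \<Phi>_ball: "\<Phi> (canonical_embedding x) = 0" if "norm x \<le> 1" for x :: 'a
  proof -
    have "x \<in> closure (range d)" using d(2) that by auto
    then show ?thesis
      by (rule continuous_constant_on_closure[rotated 2])
         (use \<Phi>_d in \<open>auto intro!: continuous_intros continuous_on_subset[OF cont_J(1)]\<close>)
  qed
  have \<Phi>_X: "\<Phi> (canonical_embedding x) = 0" for x :: 'a
  proof -
    have "\<Phi> (canonical_embedding x) = norm x * \<Phi> (canonical_embedding (sgn x))"
      by (cases "x = 0")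
         (simp_all add: sgn_div_norm linear_0[OF linear_canonical_embedding]
            linear_scale[OF linear_canonical_embedding] blinfun.scaleR_right)
    then show ?thesis using \<Phi>_ball[of "sgn x"] by (simp add: norm_sgn)
  qed

  have lower: "1 \<le> norm (?J x + h)" for x
  proof -
    have "1 \<le> (?J x + h) \<Phi>" using h_\<Phi> \<Phi>_X by (simp add: blinfun.add_left)
    also have "\<dots> \<le> norm (?J x + h) * norm \<Phi>"
      using norm_blinfun[of "?J x + h" \<Phi>] by simp
    also have "\<dots> \<le> norm (?J x + h)" using \<Phi>_norm by (simp add: mult_left_le)
    finally show ?thesis .
  qed
  have "norm (?J (d i) + h) \<le> 1" for i
  proof (rule field_le_epsilon)
    fix \<delta> :: real assume "\<delta> > 0"
    show "norm (?J (d i) + h) \<le> 1 + \<delta>"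
    proof (rule norm_add_generalized_limit_le[OF h])
      show "eventually (\<lambda>n. norm (canonical_embedding (d i) + k n) \<le> 1 + \<delta>) sequentially"
        using small[OF \<open>\<delta> > 0\<close>] eventually_gt_at_top[of i]
      proof eventually_elim
        case (elim n)
        then show ?case using k_norm[of "d i" n] by auto
      qed
    qed
  qed
  then have upper: "norm (?J x + h) \<le> 1" if "norm x \<le> 1" for x
  proof -
    have "x \<in> closure (range d)" using d(2) that by auto
    then show ?thesis
      by (rule continuous_le_on_closure[rotated])
         (use \<open>\<And>i. norm (?J (d i) + h) \<le> 1\<close>
           in \<open>auto intro!: continuous_intros continuous_on_subset[OF cont_J(2)]\<close>)
  qed
  show thesis
  proof (rule that, rule max_norm_if_unit_ball)
    show "linear ?J"
      using linear_compose[OF linear_canonical_embedding linear_canonical_embedding]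
      by (simp add: o_def)
  qed (use upper lower in \<open>auto simp: norm_canonical_embedding\<close>)
qed

theorem proposition4p2:
  assumes "separable_space (euclidean :: 'a::banach topology)"
  shows "almost_square TYPE('a) \<longleftrightarrow>
    (\<exists>h :: 'a bidual bidual. h \<noteq> 0 \<and>
       (\<forall>x :: 'a. norm (canonical_embedding (canonical_embedding x) + h) = max (norm x) (norm h)))"
proof
  assume "almost_square TYPE('a)"
  then obtain h :: "'a bidual bidual"
    where h: "\<And>x :: 'a. norm (canonical_embedding (canonical_embedding x) + h) = max (norm x) 1"
    using almost_square_imp_fourth_dual_element[OF assms] by blast
  have "norm h = 1" using h[of 0] by (simp add: linear_0[OF linear_canonical_embedding])
  with h show "\<exists>h :: 'a bidual bidual. h \<noteq> 0 \<and>
       (\<forall>x :: 'a. norm (canonical_embedding (canonical_embedding x) + h) = max (norm x) (norm h))"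
    by (intro exI[of _ h]) auto
next
  assume "\<exists>h :: 'a bidual bidual. h \<noteq> 0 \<and>
       (\<forall>x :: 'a. norm (canonical_embedding (canonical_embedding x) + h) = max (norm x) (norm h))"
  then show "almost_square TYPE('a)" using fourth_dual_element_imp_almost_square by blast
qed

end
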